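(* Let $I,J,p,(d_{ij})$ be an instance of the $p$-center problem. Let $$\mathcal P(PC1)=\Big\{(x,y,z)\in\mathbb R^{|I|\cdot|J|+|J|+1}:\ \sum_{j\in J}y_j=p;\ \sum_{j\in J}x_{ij}=1\ \forall i\in I;\ x_{ij}\le y_j\ \forall i\in I,\forall j\in J;\ \sum_{j\in J}d_{ij}x_{ij}\le z\ \forall i\in I;\ x_{ij}\ge 0\ \forall i\in I,\forall j\in J;\ 0\le y_j\le 1\ \forall j\in J\Big\}$$ and $$\mathcal P(PC2)=\Big\{(y,z)\in\mathbb R^{|J|+1}:\ \sum_{j\in J}y_j=p;\ z\ge d_{ij}-\sum_{j'\in J:\,d_{ij'}<d_{ij}}(d_{ij}-d_{ij'})y_{j'}\ \forall i\in I,\forall j\in J;\ 0\le y_j\le 1\ \forall j\in J\Big\}.$$ Then $\mathcal P(PC2)$ is the projection of $\mathcal P(PC1)$ to the space of $(y,z)$-variables, i.e. $$\mathcal P(PC2)=\{(y,z)\in\mathbb R^{|J|+1}:\ \exists x\in\mathbb R^{|I|\cdot|J|}:\ (x,y,z)\in\mathcal P(PC1)\}.$$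
   Context: An instance of the $p$-center problem consists of a finite nonempty set $I$ of customer demand points, a finite nonempty set $J$ of potential facility locations, an integer $p$ with $1\le p\le |J|$, and real distances $d_{ij}\ge 0$ for $i\in I$, $j\in J$. *)

theory Defs
  imports "HOL-Analysis.Analysis"
begin

text \<open>
  The customers and the facility locations are the elements of two arbitrary types
  of class \<^class>\<open>finite\<close>, so both sets are finite and nonempty.
  The distance \<open>d i j\<close> is input data, hence a plain function; the decision variables are vectors,
  with \<open>x $ i $ j\<close> the assignment of customer \<open>i\<close> to location \<open>j\<close>.
\<close>

definition pcenter_instance :: "int \<Rightarrow> ('i::finite \<Rightarrow> 'j::finite \<Rightarrow> real) \<Rightarrow> bool" where
  "pcenter_instance p d \<longleftrightarrow> 1 \<le> p \<and> p \<le> int CARD('j) \<and> (\<forall>i j. 0 \<le> d i j)"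

definition PC1 ::
  "int \<Rightarrow> ('i::finite \<Rightarrow> 'j::finite \<Rightarrow> real) \<Rightarrow> ((real ^ 'j ^ 'i) \<times> (real ^ 'j) \<times> real) set" where
  "PC1 p d = {(x, y, z).
     (\<Sum>j\<in>UNIV. y $ j) = of_int p \<and>
     (\<forall>i. (\<Sum>j\<in>UNIV. x $ i $ j) = 1) \<and>
     (\<forall>i j. x $ i $ j \<le> y $ j) \<and>
     (\<forall>i. (\<Sum>j\<in>UNIV. d i j * x $ i $ j) \<le> z) \<and>
     (\<forall>i j. 0 \<le> x $ i $ j) \<and>
     (\<forall>j. 0 \<le> y $ j \<and> y $ j \<le> 1)}"

definition PC2 ::
  "int \<Rightarrow> ('i::finite \<Rightarrow> 'j::finite \<Rightarrow> real) \<Rightarrow> ((real ^ 'j) \<times> real) set" where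
  "PC2 p d = {(y, z).
     (\<Sum>j\<in>UNIV. y $ j) = of_int p \<and>
     (\<forall>i j. z \<ge> d i j - (\<Sum>j' | d i j' < d i j. (d i j - d i j') * y $ j')) \<and>
     (\<forall>j. 0 \<le> y $ j \<and> y $ j \<le> 1)}"

end

theory Submission
  imports Defs
begin

text \<open>
  For fixed \<open>y\<close>, the conditions on \<open>x\<close> decouple over the customers: customer \<open>i\<close> has to
  distribute one unit of demand over the locations, with capacity \<open>y\<^sub>j\<close> at \<open>j\<close> and
  unit cost \<open>d\<^sub>i\<^sub>j\<close>, at total cost at most \<open>z\<close>.  So \<open>z\<close> is feasible if and only if it
  is at least the optimal cost of this fractional knapsack problem, for every customer.

  The inequalities of the second formulation express this optimal cost by duality.  For
  every threshold \<open>t\<close>, the number \<open>t - (\<Sum>c\<^sub>j < t. (t - c\<^sub>j) * y\<^sub>j)\<close> is a lower bound on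
  the cost of every assignment (\<open>unit_assignment_cost_lower_bound\<close>): charge \<open>t\<close> for the
  whole unit and refund \<open>t - c\<^sub>j\<close> for the full capacity of each location cheaper than \<open>t\<close>.
  Conversely, filling the locations in the order of increasing cost attains this bound when
  \<open>t\<close> is the cost of the location at which the unit is used up
  (\<open>greedy_unit_assignment\<close>).  Hence thresholds taken from the costs suffice, and the
  two systems have the same solutions \<open>(y, z)\<close>.
\<close>

text \<open>
  As the weights \<open>x\<close> sum to one, both bounds come from reading the cost as the threshold
  plus the average deviation from it.
\<close>

lemma weighted_sum_around_threshold:
  fixes c x :: "'a \<Rightarrow> real"
  assumes "sum x A = 1"
  shows "(\<Sum>j\<in>A. c j * x j) = t + (\<Sum>j\<in>A. (c j - t) * x j)"
  using assms by (simp add: left_diff_distrib sum_subtractf flip: sum_distrib_left)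

text \<open>
  This is weak duality: a term of the deviation is nonnegative where \<open>c j \<ge> t\<close>, and where
  \<open>c j < t\<close> it is smallest when \<open>x j\<close> uses the full capacity \<open>y j\<close>.
\<close>

lemma unit_assignment_cost_lower_bound:
  fixes c x y :: "'a \<Rightarrow> real"
  assumes "finite A" and "sum x A = 1"
    and x: "\<And>j. j \<in> A \<Longrightarrow> 0 \<le> x j" "\<And>j. j \<in> A \<Longrightarrow> x j \<le> y j"
  shows "t - (\<Sum>j | j \<in> A \<and> c j < t. (t - c j) * y j) \<le> (\<Sum>j\<in>A. c j * x j)"
proof -
  have "- (\<Sum>j | j \<in> A \<and> c j < t. (t - c j) * y j)
      = (\<Sum>j\<in>A. if c j < t then (c j - t) * y j else 0)"
    using \<open>finite A\<close> by (auto simp: sum.inter_filter algebra_simps simp flip: sum_negf intro!: sum.cong)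
  also have "\<dots> \<le> (\<Sum>j\<in>A. (c j - t) * x j)"
    using x by (intro sum_mono) (auto intro: mult_left_mono_neg)
  finally show ?thesis
    using weighted_sum_around_threshold[OF assms(2), of c t] by simp
qed

text \<open>
  The critical location \<open>k\<close> is a cheapest one at which the accumulated capacity reaches one.
  All strictly cheaper locations together have capacity below one, so the greedy filling has
  to use some of the capacity available at cost \<open>c k\<close>.
\<close>

lemma obtain_critical_location:
  fixes c y :: "'a \<Rightarrow> real"
  assumes "finite A" and "1 \<le> sum y A"
  obtains k where "k \<in> A" "(\<Sum>j | j \<in> A \<and> c j < c k. y j) < 1"
    "1 \<le> (\<Sum>j | j \<in> A \<and> c j \<le> c k. y j)"
proof -
  let ?K = "{k \<in> A. 1 \<le> (\<Sum>j | j \<in> A \<and> c j \<le> c k. y j)}"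
  have "A \<noteq> {}"
    using assms(2) by auto
  then obtain m where m: "m \<in> A" "\<And>j. j \<in> A \<Longrightarrow> c j \<le> c m"
    using \<open>finite A\<close> Max_in[of "c ` A"] Max_ge[of "c ` A"] by fastforce
  then have "{j \<in> A. c j \<le> c m} = A"
    by auto
  then have "?K \<noteq> {}"
    using m assms(2) by auto
  then obtain k where k: "k \<in> ?K" "\<And>l. l \<in> ?K \<Longrightarrow> c k \<le> c l"
    using \<open>finite A\<close> ex_min_if_finite[of "c ` ?K"] by (auto simp: not_less)
  have "(\<Sum>j | j \<in> A \<and> c j < c k. y j) < 1"
  proof (cases "{j \<in> A. c j < c k} = {}")
    case True
    then show ?thesis
      by (simp only: sum.empty zero_less_one)
  next
    case False
    then obtain l where l: "l \<in> A" "c l < c k" "\<And>j. j \<in> A \<Longrightarrow> c j < c k \<Longrightarrow> c j \<le> c l"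
      using \<open>finite A\<close> Max_in[of "c ` {j \<in> A. c j < c k}"] Max_ge[of "c ` {j \<in> A. c j < c k}"]
      by fastforce
    then have "{j \<in> A. c j < c k} = {j \<in> A. c j \<le> c l}"
      by auto
    moreover have "l \<notin> ?K"
      using k(2) l(2) by fastforce
    ultimately show ?thesis
      using l(1) by simp
  qed
  with k(1) that show thesis
    by blast
qed

text \<open>
  The greedy filling uses all capacity cheaper than the critical cost and a common fraction
  of the capacity at that cost.  It only deviates from the threshold \<open>c k\<close> on locations
  filled completely, which makes the lower bound tight.
\<close>

lemma greedy_unit_assignment:
  fixes c y :: "'a \<Rightarrow> real"
  assumes "finite A" and y: "\<And>j. j \<in> A \<Longrightarrow> 0 \<le> y j" and "1 \<le> sum y A"
  obtains x k where "k \<in> A" "sum x A = 1"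
    "\<And>j. j \<in> A \<Longrightarrow> 0 \<le> x j" "\<And>j. j \<in> A \<Longrightarrow> x j \<le> y j"
    "(\<Sum>j\<in>A. c j * x j) = c k - (\<Sum>j | j \<in> A \<and> c j < c k. (c k - c j) * y j)"
proof -
  obtain k where k: "k \<in> A" "(\<Sum>j | j \<in> A \<and> c j < c k. y j) < 1"
    "1 \<le> (\<Sum>j | j \<in> A \<and> c j \<le> c k. y j)"
    using obtain_critical_location[OF assms(1,3)] by blast
  define L where "L = (\<Sum>j | j \<in> A \<and> c j < c k. y j)"
  define E where "E = (\<Sum>j | j \<in> A \<and> c j = c k. y j)"
  define r where "r = (1 - L) / E"
  define x where "x j = (if c j < c k then y j else 0) + (if c j = c k then r * y j else 0)" for j
  have "{j \<in> A. c j \<le> c k} = {j \<in> A. c j < c k} \<union> {j \<in> A. c j = c k}"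
    by auto
  then have "(\<Sum>j | j \<in> A \<and> c j \<le> c k. y j) = L + E"
    unfolding L_def E_def using \<open>finite A\<close> by (simp only:) (subst sum.union_disjoint; auto)
  then have r: "0 \<le> r" "r \<le> 1" "r * E = 1 - L"
    using k(2,3) unfolding r_def L_def[symmetric] by (auto simp: field_simps)
  have "sum x A = L + r * E"
    unfolding x_def L_def E_def using \<open>finite A\<close>
    by (simp add: sum.distrib sum_distrib_left flip: sum.inter_filter)
  then have x1: "sum x A = 1"
    using r(3) by simp
  have "(\<Sum>j\<in>A. (c j - c k) * x j) = (\<Sum>j\<in>A. if c j < c k then (c j - c k) * y j else 0)"
    by (intro sum.cong) (auto simp: x_def)
  also have "\<dots> = - (\<Sum>j | j \<in> A \<and> c j < c k. (c k - c j) * y j)"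
    using \<open>finite A\<close> by (auto simp: sum.inter_filter algebra_simps simp flip: sum_negf intro!: sum.cong)
  finally have "(\<Sum>j\<in>A. c j * x j) = c k - (\<Sum>j | j \<in> A \<and> c j < c k. (c k - c j) * y j)"
    using weighted_sum_around_threshold[OF x1, of c "c k"] by simp
  moreover have "0 \<le> x j" "x j \<le> y j" if "j \<in> A" for j
    using y[OF that] r(1,2) by (auto simp: x_def mult_left_le_one_le)
  ultimately show thesis
    using that k(1) x1 by blast
qed

theorem theorem1:
  fixes p :: int
    and d :: "'i::finite \<Rightarrow> 'j::finite \<Rightarrow> real"
  assumes "pcenter_instance p d"
  shows "PC2 p d = {(y, z). \<exists>x. (x, y, z) \<in> PC1 p d}"
proof (intro set_eqI iffI; clarify)
  fix y :: "real ^ 'j" and z :: real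
  assume yz: "(y, z) \<in> PC2 p d"
  \<comment> \<open>Opening at least one centre provides every customer with enough total capacity.\<close>
  have cap: "1 \<le> (\<Sum>j\<in>UNIV. y $ j)"
    using assms yz by (simp add: PC2_def pcenter_instance_def)
  have "\<exists>x. (\<Sum>j\<in>UNIV. x j) = 1 \<and> (\<forall>j. 0 \<le> x j \<and> x j \<le> y $ j) \<and>
    (\<Sum>j\<in>UNIV. d i j * x j) \<le> z" for i
  proof -
    obtain x k where x: "sum x UNIV = 1" "\<And>j. 0 \<le> x j" "\<And>j. x j \<le> y $ j"
      and cost: "(\<Sum>j\<in>UNIV. d i j * x j)
        = d i k - (\<Sum>j | d i j < d i k. (d i k - d i j) * y $ j)"
      using greedy_unit_assignment[of UNIV "\<lambda>j. y $ j" "d i"] cap yz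
      by (auto simp: PC2_def)
    have "(\<Sum>j\<in>UNIV. d i j * x j) \<le> z"
      unfolding cost using yz by (auto simp: PC2_def)
    with x show ?thesis
      by blast
  qed
  then obtain X where "\<forall>i. (\<Sum>j\<in>UNIV. X i j) = 1 \<and> (\<forall>j. 0 \<le> X i j \<and> X i j \<le> y $ j) \<and>
    (\<Sum>j\<in>UNIV. d i j * X i j) \<le> z"
    by metis
  then have "((\<chi> i j. X i j), y, z) \<in> PC1 p d"
    using yz by (simp add: PC1_def PC2_def)
  then show "\<exists>x. (x, y, z) \<in> PC1 p d"
    by blast
next
  fix y :: "real ^ 'j" and z :: real and x :: "real ^ 'j ^ 'i"
  assume xyz: "(x, y, z) \<in> PC1 p d"
  have "d i j - (\<Sum>j' | d i j' < d i j. (d i j - d i j') * y $ j') \<le> z" for i j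
  proof -
    have "d i j - (\<Sum>j' | d i j' < d i j. (d i j - d i j') * y $ j')
        \<le> (\<Sum>j'\<in>UNIV. d i j' * x $ i $ j')"
      using unit_assignment_cost_lower_bound[of UNIV "\<lambda>j. x $ i $ j" "\<lambda>j. y $ j" "d i j" "d i"] xyz
      by (simp add: PC1_def)
    also have "\<dots> \<le> z"
      using xyz by (simp add: PC1_def)
    finally show ?thesis .
  qed
  then show "(y, z) \<in> PC2 p d"
    using xyz by (simp add: PC1_def PC2_def)
qed

end
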